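(* Let $Q \in \mathbb{R}^{m \times n}$ have orthonormal columns, let $b \in \mathbb{R}^m$, and let $$x = \operatorname{arg\,min}_{z \in \mathbb{R}^n} \|Qz - b\| = Q^\top b.$$ Let $X \in \mathbb{R}^{n \times q}$ have orthonormal columns with $q < n$, and suppose that $x \notin \mathrm{col}(X)$. Then there exists a matrix $B \in \mathbb{R}^{m \times n}$ such that $BX = QX$ and $\kappa(B) = 1$, but the least squares solution $$y = \operatorname{arg\,min}_{z \in \mathbb{R}^n} \|Bz - b\|$$ satisfies $\|y - x\| = 2 \cdot \mathrm{dist}(x, \mathrm{col}(X))$. In particular, $y \ne x$.
   Context: $\|\cdot\|$ is the Euclidean norm. $\kappa(B) = \sigma_{\max}(B)/\sigma_{\min}(B)$ is the condition number, where $\sigma_{\max}(B)$ and $\sigma_{\min}(B)$ are the largest and smallest singular values of $B$. $\mathrm{col}(X)$ is the column space of $X$, and $\mathrm{dist}(x, \mathrm{col}(X))$ is the Euclidean distance from $x$ to $\mathrm{col}(X)$. *)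

theory Defs
  imports "HOL-Analysis.Analysis"
begin

text \<open>An \<open>m \<times> n\<close> real matrix has type \<open>real^'n^'m\<close>: the index type of the rows comes last.\<close>

definition orthonormal_columns :: "real^'n^'m \<Rightarrow> bool" where
  "orthonormal_columns A \<longleftrightarrow>
     (\<forall>j. norm (column j A) = 1) \<and>
     (\<forall>i j. i \<noteq> j \<longrightarrow> orthogonal (column i A) (column j A))"

definition column_space :: "real^'n^'m \<Rightarrow> (real^'m) set" where
  "column_space A = span (columns A)"

text \<open>Left and right singular vectors are both required to be unit vectors. Hence 0 is a singular
  value iff the rank is less than \<open>min m n\<close>, so these are the distinct values among the usual
  \<open>min m n\<close> singular values, whether \<open>m \<ge> n\<close> or \<open>m < n\<close>.\<close>

definition singular_values :: "real^'n^'m \<Rightarrow> real set" where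
  "singular_values A =
     {s. 0 \<le> s \<and> (\<exists>u v. norm u = 1 \<and> norm v = 1 \<and>
            A *v v = s *\<^sub>R u \<and> transpose A *v u = s *\<^sub>R v)}"

definition sigma_max :: "real^'n^'m \<Rightarrow> real" where
  "sigma_max A = Max (singular_values A)"

definition sigma_min :: "real^'n^'m \<Rightarrow> real" where
  "sigma_min A = Min (singular_values A)"

text \<open>For a rank-deficient matrix, division by zero makes this 0 rather than infinity; a matrix of
  full rank has condition number at least 1.\<close>

definition condition_number :: "real^'n^'m \<Rightarrow> real" where
  "condition_number A = sigma_max A / sigma_min A"

text \<open>The arg min as the set of all minimizers; being a singleton expresses that the least squares
  solution exists and is unique.\<close>

definition least_squares_solutions :: "real^'n^'m \<Rightarrow> real^'m \<Rightarrow> (real^'n) set" where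
  "least_squares_solutions A b = {z. is_arg_min (\<lambda>z. norm (A *v z - b)) (\<lambda>_. True) z}"

end

theory Submission
  imports Defs
begin

text \<open>Let \<open>r\<close> be the component of \<open>x\<close> orthogonal to \<open>col(X)\<close> and let \<open>H\<close> be the Householder
  reflection along \<open>r\<close>. It fixes \<open>col(X)\<close>, so \<open>B = QH\<close> agrees with \<open>Q\<close> on \<open>X\<close>, and \<open>B\<close> again
  has orthonormal columns. Its least squares solution is \<open>H\<^sup>T Q\<^sup>T b = H x = x - 2 r\<close>, and the norm of
  \<open>r\<close> is the distance of \<open>x\<close> from \<open>col(X)\<close>.\<close>

lemma orthonormal_columns_iff:
  "orthonormal_columns A \<longleftrightarrow> transpose A ** A = mat 1"
  by (auto simp: orthonormal_columns_def matrix_mult_transpose_dot_column vec_eq_iff mat_def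
      orthogonal_def norm_eq_1)

lemma orthonormal_columns_transpose_mult:
  fixes A :: "real^'n^'m"
  assumes "orthonormal_columns A"
  shows "transpose A *v (A *v v) = v"
  using assms by (simp add: orthonormal_columns_iff matrix_vector_mul_assoc)

lemma norm_orthonormal_columns_mult:
  fixes A :: "real^'n^'m"
  assumes "orthonormal_columns A"
  shows "norm (A *v v) = norm v"
proof -
  have "(A *v v) \<bullet> (A *v v) = (transpose A *v (A *v v)) \<bullet> v"
    by (simp add: dot_lmul_matrix)
  also have "\<dots> = v \<bullet> v"
    by (simp only: orthonormal_columns_transpose_mult[OF assms])
  finally show ?thesis
    by (simp add: norm_eq)
qed

text \<open>\<open>A\<close> preserves norms, so \<open>A *v v = s *\<^sub>R u\<close> with unit
  vectors \<open>u\<close>, \<open>v\<close> and \<open>0 \<le> s\<close> forces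
  \<open>s = 1\<close>. Conversely, any unit vector \<open>v\<close>, for instance a standard basis
  vector, together with \<open>u = A *v v\<close> is a singular pair for 1.\<close>

lemma singular_values_orthonormal_columns:
  fixes A :: "real^'n^'m"
  assumes A: "orthonormal_columns A"
  shows "singular_values A = {1}"
proof (intro set_eqI iffI)
  fix s assume "s \<in> singular_values A"
  then obtain u v where s: "0 \<le> s" and v: "norm v = 1"
    and Av: "A *v v = s *\<^sub>R u" and Au: "transpose A *v u = s *\<^sub>R v"
    and u: "norm u = 1"
    by (auto simp: singular_values_def)
  have "norm (A *v v) = s"
    using s u Av by simp
  then show "s \<in> {1}"
    using norm_orthonormal_columns_mult[OF A] v by simp
next
  fix s :: real assume "s \<in> {1}"
  moreover obtain v :: "real^'n" where v: "norm v = 1"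
    using norm_axis_1 by blast
  ultimately show "s \<in> singular_values A"
    using v norm_orthonormal_columns_mult[OF A, of v] orthonormal_columns_transpose_mult[OF A, of v]
    by (auto simp: singular_values_def intro!: exI[of _ "A *v v"] exI[of _ v])
qed

lemma condition_number_orthonormal_columns:
  "orthonormal_columns A \<Longrightarrow> condition_number A = 1"
  by (simp add: condition_number_def sigma_max_def sigma_min_def singular_values_orthonormal_columns)

text \<open>The residual at \<open>x = transpose A *v b\<close> is orthogonal to the range of
  \<open>A\<close>, so by Pythagoras the squared objective is \<open>(norm (z - x))\<^sup>2\<close>
  plus a constant. This gives both minimality and uniqueness.\<close>

lemma least_squares_solutions_orthonormal_columns:
  fixes A :: "real^'n^'m"
  assumes A: "orthonormal_columns A"
  shows "least_squares_solutions A b = {transpose A *v b}"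
proof -
  define x where "x = transpose A *v b"
  have pyth: "(norm (A *v z - b))\<^sup>2 = (norm (z - x))\<^sup>2 + (norm (A *v x - b))\<^sup>2" for z
  proof -
    have "(A *v (z - x)) \<bullet> (A *v x - b) = (z - x) \<bullet> (transpose A *v (A *v x - b))"
      by (metis dot_lmul_matrix inner_commute transpose_matrix_vector)
    also have "\<dots> = 0"
      by (simp add: matrix_vector_mult_diff_distrib orthonormal_columns_transpose_mult[OF A] x_def
          del: transpose_matrix_vector)
    finally have "(norm (A *v (z - x) + (A *v x - b)))\<^sup>2 = (norm (A *v (z - x)))\<^sup>2 + (norm (A *v x - b))\<^sup>2"
      by (simp add: norm_add_Pythagorean orthogonal_def)
    moreover have "A *v z - b = A *v (z - x) + (A *v x - b)"
      by (simp add: matrix_vector_mult_diff_distrib)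
    ultimately show ?thesis
      by (simp only: norm_orthonormal_columns_mult[OF A])
  qed
  have le: "norm (A *v x - b) \<le> norm (A *v z - b)" for z
    by (rule power2_le_imp_le) (simp_all add: pyth[of z])
  moreover have "z = x" if "norm (A *v z - b) \<le> norm (A *v x - b)" for z
    using pyth[of z] le[of z] that by simp
  ultimately show ?thesis
    unfolding least_squares_solutions_def is_arg_min_linorder x_def[symmetric] by auto
qed

text \<open>The bound \<open>norm r\<close> is attained at \<open>p\<close>. For any other
  \<open>w\<close> in \<open>S\<close>, Pythagoras applies to \<open>r + (p - w)\<close>, since
  \<open>p - w\<close> stays in \<open>S\<close>.\<close>

lemma infdist_orthogonal_decomp:
  fixes S :: "'a::real_inner set"
  assumes S: "subspace S" and p: "p \<in> S" and r: "\<And>w. w \<in> S \<Longrightarrow> orthogonal r w"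
  shows "infdist (p + r) S = norm r"
proof (rule antisym)
  show "infdist (p + r) S \<le> norm r"
    using infdist_le[OF p, of "p + r"] by (simp add: dist_norm)
  have "norm r \<le> dist (p + r) w" if "w \<in> S" for w
  proof (rule power2_le_imp_le)
    have "orthogonal r (p - w)"
      using r subspace_diff[OF S p that] by blast
    then have "(norm (r + (p - w)))\<^sup>2 = (norm r)\<^sup>2 + (norm (p - w))\<^sup>2"
      by (rule norm_add_Pythagorean)
    then show "(norm r)\<^sup>2 \<le> (dist (p + r) w)\<^sup>2"
      by (simp add: dist_norm algebra_simps)
  qed simp
  \<comment> \<open>\<open>infdist\<close> is 0 by default on the empty set; the point
    \<open>p\<close> rules this case out.\<close>
  then show "norm r \<le> infdist (p + r) S"
    using p by (auto simp: infdist_def intro!: cINF_greatest)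
qed

text \<open>The Householder reflection in the hyperplane orthogonal to \<open>r\<close>. For
  \<open>r = 0\<close> it is the identity, so the lemmas below hold for every
  \<open>r\<close>.\<close>

definition reflect_along :: "'a::real_inner \<Rightarrow> 'a \<Rightarrow> 'a" where
  "reflect_along r v = v - (2 * (v \<bullet> r) / (r \<bullet> r)) *\<^sub>R r"

lemma linear_reflect_along: "linear (reflect_along r)"
  by (rule linearI) (simp_all add: reflect_along_def inner_left_distrib add_divide_distrib
      distrib_left scaleR_add_left scaleR_diff_right)

lemma reflect_along_involution: "reflect_along r (reflect_along r v) = v"
  by (cases "r = 0") (simp_all add: reflect_along_def inner_diff_left scaleR_diff_left
      diff_divide_distrib right_diff_distrib)

lemma orthogonal_transformation_reflect_along: "orthogonal_transformation (reflect_along r)"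
  unfolding orthogonal_transformation_def
proof (intro conjI allI)
  show "reflect_along r v \<bullet> reflect_along r w = v \<bullet> w" for v w
    by (cases "r = 0") (simp_all add: reflect_along_def inner_diff_left inner_diff_right
        inner_commute[of r w])
qed (rule linear_reflect_along)

theorem proposition8p1:
  fixes Q :: "real^'n^'m" and b :: "real^'m" and X :: "real^'q^'n"
  assumes "orthonormal_columns Q"
    and "orthonormal_columns X"
    and "CARD('q) < CARD('n)"
  shows "\<exists>x. least_squares_solutions Q b = {x} \<and> x = transpose Q *v b \<and>
    (x \<notin> column_space X \<longrightarrow>
      (\<exists>(B :: real^'n^'m) y.
         B ** X = Q ** X \<and>
         condition_number B = 1 \<and>
         least_squares_solutions B b = {y} \<and>
         norm (y - x) = 2 * infdist x (column_space X) \<and>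
         y \<noteq> x))"
proof (rule exI[of _ "transpose Q *v b"], intro conjI impI)
  let ?x = "transpose Q *v b"
  show "least_squares_solutions Q b = {?x}"
    by (rule least_squares_solutions_orthonormal_columns[OF assms(1)])
  assume x: "?x \<notin> column_space X"
  obtain p r where p: "p \<in> column_space X" and x_eq: "?x = p + r"
    and r: "\<And>w. w \<in> column_space X \<Longrightarrow> orthogonal r w"
    using orthogonal_subspace_decomp_exists[of "columns X" ?x] unfolding column_space_def by metis
  have "r \<noteq> 0"
    using x p x_eq by auto
  define H :: "real^'n^'n" where "H = matrix (reflect_along r)"
  have H: "H *v v = reflect_along r v" for v
    unfolding H_def by (rule matrix_works) (simp add: linear_matrix_vector_mul_eq linear_reflect_along)
  have HH: "transpose H ** H = mat 1"
    using orthogonal_transformation_reflect_along[of r]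
    by (simp add: H_def orthogonal_transformation_matrix orthogonal_matrix)
  \<comment> \<open>An orthogonal involution is symmetric: evaluate
    \<open>transpose H ** H = mat 1\<close> at \<open>H *v v\<close> and use
    \<open>H *v (H *v v) = v\<close>.\<close>
  have HT: "transpose H *v v = H *v v" for v
  proof -
    have "transpose H *v (H *v (H *v v)) = H *v v"
      by (metis HH matrix_vector_mul_assoc matrix_vector_mul_lid)
    then show ?thesis
      by (simp add: H reflect_along_involution)
  qed
  have B: "orthonormal_columns (Q ** H)"
    using assms(1) HH unfolding orthonormal_columns_iff
    by (metis matrix_mul_assoc matrix_mul_lid matrix_transpose_mul)
  \<comment> \<open>The columns of \<open>X\<close> are orthogonal to \<open>r\<close>, so the
    reflection moves none of them; columnwise this yields \<open>H ** X = X\<close>.\<close>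
  have "H *v column j X = column j X" for j
  proof -
    have "orthogonal r (column j X)"
      by (rule r) (auto simp: column_space_def columns_def intro: span_base)
    then show ?thesis
      by (simp add: H reflect_along_def orthogonal_def inner_commute)
  qed
  then have HX: "H ** X = X"
    by (simp add: vec_eq_iff column_def matrix_matrix_mult_def matrix_vector_mult_def)
  have BX: "(Q ** H) ** X = Q ** X"
    by (metis HX matrix_mul_assoc)
  let ?y = "transpose (Q ** H) *v b"
  have "?y = H *v ?x"
    using HT by (simp only: matrix_transpose_mul matrix_vector_mul_assoc[symmetric])
  \<comment> \<open>As \<open>p\<close> is orthogonal to \<open>r\<close>, the coefficient of
    \<open>r\<close> in the reflection of \<open>?x\<close> is exactly 2, which is the factor in the
    claim.\<close>
  moreover have "?x \<bullet> r = r \<bullet> r"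
    unfolding x_eq using r[OF p] by (simp add: inner_left_distrib orthogonal_def inner_commute[of r p])
  ultimately have y: "?y - ?x = - 2 *\<^sub>R r"
    using \<open>r \<noteq> 0\<close> by (simp add: H reflect_along_def del: transpose_matrix_vector)
  have "infdist ?x (column_space X) = norm r"
    unfolding x_eq using infdist_orthogonal_decomp[OF _ p r] by (simp add: column_space_def)
  then have norm_y: "norm (?y - ?x) = 2 * infdist ?x (column_space X)"
    unfolding y by simp
  have "?y \<noteq> ?x"
    using y \<open>r \<noteq> 0\<close> by auto
  then show "\<exists>(B :: real^'n^'m) y. B ** X = Q ** X \<and> condition_number B = 1 \<and>
      least_squares_solutions B b = {y} \<and> norm (y - ?x) = 2 * infdist ?x (column_space X) \<and> y \<noteq> ?x"
    using BX norm_y condition_number_orthonormal_columns[OF B]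
      least_squares_solutions_orthonormal_columns[OF B] by blast
qed (rule refl)

end
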